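(* Consider the drive Hopfield neural network $$\dot{x}=-Cx+Wf(x)+I,\qquad x\in\mathbb{R}^3,$$ and the response Hopfield neural network $$\dot{y}=-\widetilde{C}y+\widetilde{W}f(y)+\lambda g(x(t)),\qquad y\in\mathbb{R}^3,$$ where $x(t)$ is an output (solution) of the drive network, under the standing assumptions listed in the context. Suppose that there is a constant $L>0$ such that $$\|g(x)-g(\overline{x})\|\ge L\|x-\overline{x}\|\quad\text{for all } x,\overline{x}\in\Lambda_x .$$ Then the response network admits sensitivity, i.e., there exist numbers $\widetilde{\epsilon}>0$ and $\widetilde{\Delta}>0$ such that for every $\widetilde{\delta}>0$, every $\alpha_1\in\Lambda_y$ and every chaotic output $x(t)$ of the drive network, there exist $\alpha_2\in\Lambda_y$, a chaotic output $\widetilde{x}(t)$ of the drive network, and an interval $\widetilde{J}\subset[0,\infty)$ of length at least $\widetilde{\Delta}$ such that $\|\alpha_1-\alpha_2\|<\widetilde{\delta}$ and $$\|\varphi_x(t,0,\alpha_1)-\varphi_{\widetilde{x}}(t,0,\alpha_2)\|>\widetilde{\epsilon}\quad\text{for all } t\in\widetilde{J}.$$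
   Context: Norms: Euclidean norm on vectors, spectral norm on $3\times 3$ matrices. For $u=(u_1,u_2,u_3)^T$, $f(u)=(\tanh u_1,\tanh u_2,\tanh u_3)^T$. In the drive network, $C=\mathrm{diag}(c_1,c_2,c_3)$ with $c_i>0$, $W$ is a real $3\times 3$ matrix and $I\in\mathbb{R}^3$. In the response network, $\widetilde{C}=\mathrm{diag}(\widetilde c_1,\widetilde c_2,\widetilde c_3)$ with $\widetilde c_i>0$, $\widetilde{W}$ is a real $3\times3$ matrix, $\lambda$ is a nonzero real constant, and $g=(g_1,g_2,g_3)^T:\mathbb{R}^3\to\mathbb{R}^3$ with each $g_i$ continuous. Standing assumptions: the drive network possesses a chaotic attractor $\mathcal{A}$, and $\Lambda_x\subset\mathbb{R}^3$ is a compact set, invariant under the flow of the drive network, containing $\mathcal{A}$. A solution $x(t)$ of the drive network is called a chaotic output if $x(0)\in\mathcal{A}$. The drive network is sensitive: there exist $\epsilon>0$ and $\Delta>0$ such that for every $\delta>0$ and every chaotic output $x(t)$ there exist a chaotic output $\widetilde{x}(t)$ and an interval $J\subset[0,\infty)$ of length at least $\Delta$ with $\|x(0)-\widetilde{x}(0)\|<\delta$ and $\|x(t)-\widetilde{x}(t)\|>\epsilon$ for all $t\in J$. There is a bounded set $\Lambda_y\subset\mathbb{R}^3$ which is invariant under the flow of the response network for every chaotic output $x(t)$ of the drive network. For an output $x(t)$ of the drive network, $\varphi_x(t,t_0,\alpha)$ denotes the solution of the response network (driven by $x(t)$) with $\varphi_x(t_0,t_0,\alpha)=\alpha$. *)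

theory Defs
  imports "HOL-Analysis.Analysis"
begin

type_synonym vec3 = "real ^ 3"
type_synonym mat3 = "real ^ 3 ^ 3"

text \<open>Componentwise activation f(u) = (tanh u1, tanh u2, tanh u3).\<close>
definition tanh_vec :: "vec3 \<Rightarrow> vec3" where
  "tanh_vec u = (\<chi> i. tanh (u $ i))"

text \<open>Diagonal matrix diag(c1,c2,c3).\<close>
definition diag3 :: "vec3 \<Rightarrow> mat3" where
  "diag3 c = (\<chi> i j. if i = j then c $ i else 0)"

text \<open>x is a solution (output) of the drive network  x' = -Cx + W f(x) + I  on [0,inf).\<close>
definition drive_sol :: "mat3 \<Rightarrow> mat3 \<Rightarrow> vec3 \<Rightarrow> (real \<Rightarrow> vec3) \<Rightarrow> bool" where
  "drive_sol C W I x \<longleftrightarrow>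
     (\<forall>t\<ge>0. (x has_vector_derivative (- (C *v x t) + W *v tanh_vec (x t) + I)) (at t within {0..}))"

text \<open>y is a solution of the response network  y' = -C~y + W~ f(y) + lambda g(x(t))  on [0,inf),
  driven by the drive output x.\<close>
definition resp_sol ::
  "mat3 \<Rightarrow> mat3 \<Rightarrow> real \<Rightarrow> (vec3 \<Rightarrow> vec3) \<Rightarrow> (real \<Rightarrow> vec3) \<Rightarrow> (real \<Rightarrow> vec3) \<Rightarrow> bool" where
  "resp_sol Ct Wt lam g x y \<longleftrightarrow>
     (\<forall>t\<ge>0. (y has_vector_derivative (- (Ct *v y t) + Wt *v tanh_vec (y t) + lam *\<^sub>R g (x t)))
              (at t within {0..}))"

text \<open>J is an interval contained in [0,inf) whose length is at least D
  (for an interval: it contains an open interval of length D).\<close>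
definition interval_len_ge :: "real set \<Rightarrow> real \<Rightarrow> bool" where
  "interval_len_ge J D \<longleftrightarrow> is_interval J \<and> J \<subseteq> {0..} \<and> (\<exists>a b. D \<le> b - a \<and> {a<..<b} \<subseteq> J)"

end

theory Submission
  imports Defs
begin

text \<open>
  Fix a time s at which two chaotic outputs x, x~ of the drive are \<open>\<epsilon>\<close>-apart, and start both
  responses at the same point. Their difference z is forced by p(t) = \<open>\<lambda>\<close> (g(x t) - g(x~ t)),
  which has size at least \<open>|\<lambda>| L \<epsilon>\<close> at s because g is expansive on \<open>\<Lambda>\<^sub>x\<close>. Drive outputs are
  uniformly Lipschitz and g is uniformly continuous on the compact set \<open>\<Lambda>\<^sub>x\<close>, so p stays within
  \<open>|\<lambda>| L \<epsilon> / 2\<close> of p(s) on a window [s, s+h] of fixed length. The rest of z' is bounded by K|z|,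
  so if |z| stayed below a small e on the window, the component of z along p(s) would grow by at
  least \<open>h |\<lambda>| L \<epsilon> / 4 > 2e\<close>, which is impossible. Hence |z| exceeds e somewhere, and since
  responses in the bounded set \<open>\<Lambda>\<^sub>y\<close> are uniformly Lipschitz, |z| > e/2 on an interval of
  fixed length. Uniqueness of response solutions makes this independent of the solutions chosen.
\<close>

lemma bounded_vector_derivative_imp_lipschitz:
  fixes f :: "real \<Rightarrow> 'a::real_normed_vector"
  assumes "convex S"
    and deriv: "\<And>t. t \<in> S \<Longrightarrow> (f has_vector_derivative f' t) (at t within S)"
    and bound: "\<And>t. t \<in> S \<Longrightarrow> norm (f' t) \<le> B" and "0 \<le> B"
  shows "B-lipschitz_on S f"
proof (rule bounded_derivative_imp_lipschitz[where f' = "\<lambda>t h. h *\<^sub>R f' t"])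
  show "(f has_derivative (\<lambda>h. h *\<^sub>R f' t)) (at t within S)" if "t \<in> S" for t
    using deriv[OF that] by (simp add: has_vector_derivative_def)
  show "onorm (\<lambda>h. h *\<^sub>R f' t) \<le> B" if "t \<in> S" for t
    using bound[OF that] by (simp add: onorm_scaleR_left onorm_id)
qed fact+

lemma lipschitz_norm_stays_large:
  fixes z :: "real \<Rightarrow> 'a::real_normed_vector"
  assumes lip: "M-lipschitz_on S z" and "0 < M" and "t0 \<in> S" "t \<in> S"
    and near: "\<bar>t - t0\<bar> < e / (2 * M)" and large: "e < norm (z t0)"
  shows "e / 2 < norm (z t)"
proof -
  have "norm (z t - z t0) \<le> M * \<bar>t - t0\<bar>"
    using lipschitz_on_normD[OF lip \<open>t \<in> S\<close> \<open>t0 \<in> S\<close>] by simp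
  also have "\<dots> < e / 2"
    using near \<open>0 < M\<close> by (simp add: field_simps)
  finally show ?thesis
    using large norm_triangle_ineq2[of "z t0" "z t"] norm_minus_commute[of "z t0" "z t"] by linarith
qed

lemma inner_sgn_self: "sgn w \<bullet> w = norm w" for w :: "'a::real_inner"
  by (cases "w = 0") (simp_all add: sgn_div_norm power2_norm_eq_inner[symmetric] power2_eq_square)

lemma nonpos_derivative_imp_le_initial:
  fixes q :: "real \<Rightarrow> real"
  assumes deriv: "\<And>t. a \<le> t \<Longrightarrow> (q has_real_derivative q' t) (at t within {a..})"
    and nonpos: "\<And>t. a \<le> t \<Longrightarrow> q' t \<le> 0" and "a \<le> t"
  shows "q t \<le> q a"
proof -
  have "\<exists>\<xi>\<in>{a..t}. q t - q a = (t - a) * q' \<xi>"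
  proof (rule mvt_very_simple[OF \<open>a \<le> t\<close>])
    fix \<xi> assume "a \<le> \<xi>" "\<xi> \<le> t"
    with deriv[of \<xi>] show "(q has_derivative (\<lambda>h. h * q' \<xi>)) (at \<xi> within {a..t})"
      by (simp add: has_field_derivative_def mult_commute_abs has_derivative_subset)
  qed
  then obtain \<xi> where "\<xi> \<in> {a..t}" "q t - q a = (t - a) * q' \<xi>"
    by blast
  moreover have "(t - a) * q' \<xi> \<le> 0"
    using nonpos[of \<xi>] \<open>\<xi> \<in> {a..t}\<close> by (simp add: mult_nonneg_nonpos)
  ultimately show ?thesis
    by simp
qed

lemma lipschitz_ode_solutions_unique:
  fixes y1 y2 :: "real \<Rightarrow> 'a::real_inner"
  assumes y1: "\<And>t. 0 \<le> t \<Longrightarrow> (y1 has_vector_derivative F t (y1 t)) (at t within {0..})"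
    and y2: "\<And>t. 0 \<le> t \<Longrightarrow> (y2 has_vector_derivative F t (y2 t)) (at t within {0..})"
    and lip: "\<And>t. 0 \<le> t \<Longrightarrow> K-lipschitz_on UNIV (F t)"
    and "y1 0 = y2 0" and "0 \<le> t"
  shows "y1 t = y2 t"
proof -
  define w where "w t = y1 t - y2 t" for t
  define w' where "w' t = F t (y1 t) - F t (y2 t)" for t
  define q where "q t = exp (- (2 * K) * t) * (w t \<bullet> w t)" for t
  define q' where "q' t = exp (- (2 * K) * t) * (2 * (w t \<bullet> w' t) - 2 * K * (w t \<bullet> w t))" for t
  have q_deriv: "(q has_real_derivative q' t) (at t within {0..})" if "0 \<le> t" for t
  proof -
    have "(w has_derivative (\<lambda>h. h *\<^sub>R w' t)) (at t within {0..})"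
      unfolding w_def w'_def has_vector_derivative_def[symmetric]
      using that by (intro has_vector_derivative_diff y1 y2)
    from has_derivative_inner[OF this this]
    have "((\<lambda>t. w t \<bullet> w t) has_real_derivative 2 * (w t \<bullet> w' t)) (at t within {0..})"
      by (simp add: has_field_derivative_def inner_commute algebra_simps) (simp add: mult_commute_abs)
    then show ?thesis
      unfolding q_def q'_def by (auto intro!: derivative_eq_intros simp: algebra_simps)
  qed
  \<comment> \<open>the weight \<open>exp (-2Kt)\<close> absorbs the growth allowed by the Lipschitz bound\<close>
  have q'_nonpos: "q' t \<le> 0" if "0 \<le> t" for t
  proof -
    have "w t \<bullet> w' t \<le> norm (w t) * norm (w' t)"
      by (rule norm_cauchy_schwarz)
    also have "\<dots> \<le> norm (w t) * (K * norm (w t))"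
      using lipschitz_on_normD[OF lip[OF that]] by (simp add: w_def w'_def mult_left_mono)
    also have "\<dots> = K * (w t \<bullet> w t)"
      by (simp add: power2_norm_eq_inner[symmetric] power2_eq_square)
    finally show ?thesis
      by (simp add: q'_def mult_nonneg_nonpos)
  qed
  have "q t \<le> q 0"
    using q_deriv q'_nonpos \<open>0 \<le> t\<close> by (rule nonpos_derivative_imp_le_initial)
  moreover have "q 0 = 0"
    using \<open>y1 0 = y2 0\<close> by (simp add: q_def w_def)
  ultimately have "q t \<le> 0"
    by simp
  then have "w t \<bullet> w t \<le> 0"
    by (simp add: q_def mult_le_0_iff)
  then have "w t = 0"
    by (metis inner_eq_zero_iff inner_ge_zero order_antisym)
  then show ?thesis
    by (simp add: w_def)
qed

lemma forced_solution_escapes: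
  fixes z :: "real \<Rightarrow> 'a::real_inner"
  assumes "0 < h" "0 \<le> K"
    and deriv: "\<And>t. t \<in> {s..s+h} \<Longrightarrow> (z has_vector_derivative z' t) (at t within {s..s+h})"
    and perturbation: "\<And>t. t \<in> {s..s+h} \<Longrightarrow> norm (z' t - p t) \<le> K * norm (z t)"
    and forcing_large: "P \<le> norm (p s)"
    and forcing_steady: "\<And>t. t \<in> {s..s+h} \<Longrightarrow> norm (p t - p s) \<le> P / 2"
    and e_small: "K * e \<le> P / 4" "8 * e < h * P"
  shows "\<exists>t\<in>{s..s+h}. e < norm (z t)"
proof (rule ccontr)
  assume "\<not> ?thesis"
  then have z_small: "norm (z t) \<le> e" if "t \<in> {s..s+h}" for t
    using that by force
  define u where "u = sgn (p s)"
  have "norm u \<le> 1"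
    by (simp add: u_def norm_sgn)
  then have u_inner: "\<bar>u \<bullet> v\<bar> \<le> norm v" for v
    using Cauchy_Schwarz_ineq2[of u v] mult_right_mono[of "norm u" 1 "norm v"] by simp
  \<comment> \<open>along the direction of the forcing, \<open>u \<bullet> z\<close> grows at rate at least \<open>P / 4\<close>\<close>
  have "\<exists>\<xi>\<in>{s..s+h}. u \<bullet> z (s+h) - u \<bullet> z s = (s + h - s) * (u \<bullet> z' \<xi>)"
  proof (rule mvt_very_simple)
    fix t assume "s \<le> t" "t \<le> s + h"
    with deriv[of t] show "((\<lambda>t. u \<bullet> z t) has_derivative (\<lambda>r. r * (u \<bullet> z' t))) (at t within {s..s+h})"
      by (auto simp: has_vector_derivative_def intro!: derivative_eq_intros)
  qed (use \<open>0 < h\<close> in simp)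
  then obtain \<xi> where \<xi>: "\<xi> \<in> {s..s+h}" and mvt: "u \<bullet> z (s+h) - u \<bullet> z s = h * (u \<bullet> z' \<xi>)"
    by auto
  have "u \<bullet> z' \<xi> = u \<bullet> p s + u \<bullet> (p \<xi> - p s) + u \<bullet> (z' \<xi> - p \<xi>)"
    by (simp add: inner_diff_right)
  moreover have "u \<bullet> p s = norm (p s)"
    by (simp add: u_def inner_sgn_self)
  moreover have "K * norm (z \<xi>) \<le> K * e"
    using z_small[OF \<xi>] \<open>0 \<le> K\<close> by (rule mult_left_mono)
  ultimately have "P / 4 \<le> u \<bullet> z' \<xi>"
    using u_inner[of "p \<xi> - p s"] u_inner[of "z' \<xi> - p \<xi>"] forcing_large forcing_steady[OF \<xi>]
      perturbation[OF \<xi>] e_small(1)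
    by linarith
  then have "h * P / 4 \<le> u \<bullet> z (s+h) - u \<bullet> z s"
    using mvt mult_left_mono[of "P / 4" "u \<bullet> z' \<xi>" h] \<open>0 < h\<close> by simp
  moreover have "u \<bullet> z (s+h) - u \<bullet> z s \<le> 2 * e"
    using u_inner[of "z (s+h)"] u_inner[of "z s"] z_small[of s] z_small[of "s+h"] \<open>0 < h\<close> by simp
  ultimately show False
    using e_small(2) by simp
qed

lemma interval_len_geE:
  assumes "interval_len_ge J D" "0 < D"
  obtains s where "s \<in> J" "0 \<le> s"
proof -
  obtain a b where ab: "D \<le> b - a" "{a<..<b} \<subseteq> J" and "J \<subseteq> {0..}"
    using assms(1) unfolding interval_len_ge_def by blast
  have "(a + b) / 2 \<in> J"
    using ab assms(2) by (intro subsetD[OF ab(2)]) auto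
  with \<open>J \<subseteq> {0..}\<close> show thesis
    by (intro that) auto
qed

lemma interval_len_ge_greaterThanLessThan: "0 \<le> a \<Longrightarrow> interval_len_ge {a<..<a+D} D"
  unfolding interval_len_ge_def
  by (intro conjI exI[of _ a] exI[of _ "a + D"]) (auto simp: is_interval_convex_1 convex_real_interval)

definition hopfield_field :: "mat3 \<Rightarrow> mat3 \<Rightarrow> vec3 \<Rightarrow> vec3 \<Rightarrow> vec3" where
  "hopfield_field C W b v = - (C *v v) + W *v tanh_vec v + b"

lemma drive_sol_iff:
  "drive_sol C W I x \<longleftrightarrow>
     (\<forall>t\<ge>0. (x has_vector_derivative hopfield_field C W I (x t)) (at t within {0..}))"
  by (simp add: drive_sol_def hopfield_field_def)

lemma resp_sol_iff:
  "resp_sol C W lam g x y \<longleftrightarrow>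
     (\<forall>t\<ge>0. (y has_vector_derivative hopfield_field C W (lam *\<^sub>R g (x t)) (y t)) (at t within {0..}))"
  by (simp add: resp_sol_def hopfield_field_def)

lemma abs_tanh_diff_le: "\<bar>tanh a - tanh b\<bar> \<le> \<bar>a - b\<bar>" for a b :: real
proof -
  have "\<bar>1 - tanh x ^ 2\<bar> \<le> 1" for x :: real
  proof -
    have "tanh x ^ 2 < 1"
      using tanh_real_bounds[of x] by (simp add: abs_square_less_1 abs_less_iff)
    then show ?thesis
      by simp
  qed
  then have "norm (tanh a - tanh b) \<le> 1 * norm (a - b)"
    by (intro field_differentiable_bound[where S = UNIV and f' = "\<lambda>x. 1 - tanh x ^ 2"])
      (auto simp: has_field_derivative_at_within intro!: derivative_eq_intros)
  then show ?thesis
    by simp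
qed

lemma norm_tanh_vec_diff_le: "norm (tanh_vec u - tanh_vec v) \<le> norm (u - v)"
  by (rule norm_le_componentwise_cart) (simp add: tanh_vec_def abs_tanh_diff_le)

lemma norm_hopfield_field_diff_le:
  "norm (hopfield_field C W b u - hopfield_field C W b' v - (b - b'))
     \<le> (onorm ((*v) C) + onorm ((*v) W)) * norm (u - v)"
proof -
  have "hopfield_field C W b u - hopfield_field C W b' v - (b - b')
      = W *v (tanh_vec u - tanh_vec v) - C *v (u - v)"
    by (simp add: hopfield_field_def algebra_simps matrix_vector_mult_diff_distrib)
  also have "norm \<dots> \<le> norm (W *v (tanh_vec u - tanh_vec v)) + norm (C *v (u - v))"
    by (rule norm_triangle_ineq4)
  also have "\<dots> \<le> onorm ((*v) W) * norm (tanh_vec u - tanh_vec v) + onorm ((*v) C) * norm (u - v)"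
    by (intro add_mono onorm matrix_vector_mul_bounded_linear)
  also have "\<dots> \<le> (onorm ((*v) C) + onorm ((*v) W)) * norm (u - v)"
    using mult_left_mono[OF norm_tanh_vec_diff_le onorm_pos_le[OF matrix_vector_mul_bounded_linear]]
    by (simp add: algebra_simps)
  finally show ?thesis .
qed

lemma hopfield_field_lipschitz:
  "(onorm ((*v) C) + onorm ((*v) W))-lipschitz_on UNIV (hopfield_field C W b)"
  using norm_hopfield_field_diff_le[of C W b _ b]
  by (intro lipschitz_onI) (auto simp: dist_norm intro: add_nonneg_nonneg onorm_pos_le)

lemma norm_hopfield_field_le:
  "norm (hopfield_field C W b v) \<le> (onorm ((*v) C) + onorm ((*v) W)) * norm v + norm b"
proof -
  have "tanh_vec 0 = 0"
    by (simp add: tanh_vec_def vec_eq_iff)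
  then have "hopfield_field C W b 0 = b"
    by (simp add: hopfield_field_def)
  then have "norm (hopfield_field C W b v - b) \<le> (onorm ((*v) C) + onorm ((*v) W)) * norm v"
    using norm_hopfield_field_diff_le[of C W b v b 0] by simp
  then show ?thesis
    using norm_triangle_ineq2[of "hopfield_field C W b v" b] by linarith
qed

lemma resp_sol_unique:
  assumes y1: "resp_sol C W lam g x y1" and y2: "resp_sol C W lam g x y2"
    and "y1 0 = y2 0" "0 \<le> t"
  shows "y1 t = y2 t"
proof (rule lipschitz_ode_solutions_unique[where F = "\<lambda>t. hopfield_field C W (lam *\<^sub>R g (x t))"])
  show "(y1 has_vector_derivative hopfield_field C W (lam *\<^sub>R g (x t)) (y1 t)) (at t within {0..})"
    if "0 \<le> t" for t
    using y1 that by (simp add: resp_sol_iff)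
  show "(y2 has_vector_derivative hopfield_field C W (lam *\<^sub>R g (x t)) (y2 t)) (at t within {0..})"
    if "0 \<le> t" for t
    using y2 that by (simp add: resp_sol_iff)
qed (rule hopfield_field_lipschitz assms)+

lemma hopfield_solution_lipschitz:
  assumes deriv: "\<And>t. 0 \<le> t \<Longrightarrow> (y has_vector_derivative hopfield_field C W (b t) (y t)) (at t within {0..})"
    and y_bound: "\<And>t. 0 \<le> t \<Longrightarrow> norm (y t) \<le> R"
    and b_bound: "\<And>t. 0 \<le> t \<Longrightarrow> norm (b t) \<le> B"
  shows "((onorm ((*v) C) + onorm ((*v) W)) * R + B)-lipschitz_on {0..} y"
proof (rule bounded_vector_derivative_imp_lipschitz)
  have K_nonneg: "0 \<le> onorm ((*v) C) + onorm ((*v) W)"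
    by (intro add_nonneg_nonneg onorm_pos_le matrix_vector_mul_bounded_linear)
  have "0 \<le> R" "0 \<le> B"
    using order_trans[OF norm_ge_zero y_bound, of 0] order_trans[OF norm_ge_zero b_bound, of 0] by simp_all
  with K_nonneg show "0 \<le> (onorm ((*v) C) + onorm ((*v) W)) * R + B"
    by simp
  show "norm (hopfield_field C W (b t) (y t)) \<le> (onorm ((*v) C) + onorm ((*v) W)) * R + B"
    if "t \<in> {0..}" for t
  proof -
    have "0 \<le> t"
      using that by simp
    have "norm (hopfield_field C W (b t) (y t)) \<le> (onorm ((*v) C) + onorm ((*v) W)) * norm (y t) + norm (b t)"
      by (rule norm_hopfield_field_le)
    also have "\<dots> \<le> (onorm ((*v) C) + onorm ((*v) W)) * R + B"
      using \<open>0 \<le> t\<close> by (intro add_mono mult_left_mono K_nonneg y_bound b_bound)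
    finally show ?thesis .
  qed
  show "(y has_vector_derivative hopfield_field C W (b t) (y t)) (at t within {0..})"
    if "t \<in> {0..}" for t
    using deriv that by simp
qed (simp add: convex_real_interval)

lemma resp_sol_pair_separates:
  assumes "0 < M"
    and lip1: "\<And>y. resp_sol C W lam g x y \<Longrightarrow> y 0 = a \<Longrightarrow> M-lipschitz_on {0..} y"
    and lip2: "\<And>y. resp_sol C W lam g xt y \<Longrightarrow> y 0 = a \<Longrightarrow> M-lipschitz_on {0..} y"
    and escape: "\<And>y1 y2. resp_sol C W lam g x y1 \<Longrightarrow> resp_sol C W lam g xt y2 \<Longrightarrow> y1 0 = y2 0 \<Longrightarrow>
        \<exists>t\<ge>0. e < norm (y1 t - y2 t)"
  shows "\<exists>J. interval_len_ge J (e / (4 * M)) \<and>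
    (\<forall>y1 y2. resp_sol C W lam g x y1 \<and> y1 0 = a \<and> resp_sol C W lam g xt y2 \<and> y2 0 = a \<longrightarrow>
       (\<forall>t\<in>J. e / 2 < norm (y1 t - y2 t)))"
proof (cases "\<exists>y1 y2. resp_sol C W lam g x y1 \<and> y1 0 = a \<and> resp_sol C W lam g xt y2 \<and> y2 0 = a")
  case False
  then show ?thesis
    using interval_len_ge_greaterThanLessThan[of 0 "e / (4 * M)"] by blast
next
  case True
  then obtain y1 y2 where y1: "resp_sol C W lam g x y1" "y1 0 = a"
    and y2: "resp_sol C W lam g xt y2" "y2 0 = a"
    by blast
  obtain t0 where "0 \<le> t0" and escaped: "e < norm (y1 t0 - y2 t0)"
    using escape[OF y1(1) y2(1)] y1(2) y2(2) by auto
  have diff_lip: "(M + M)-lipschitz_on {0..} (\<lambda>t. y1 t - y2 t)"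
    using lip1[OF y1] lip2[OF y2] by (rule lipschitz_on_diff)
  have far: "e / 2 < norm (y1 t - y2 t)" if "t \<in> {t0<..<t0 + e / (4 * M)}" for t
    using lipschitz_norm_stays_large[OF diff_lip _ _ _ _ escaped] that \<open>0 \<le> t0\<close> \<open>0 < M\<close>
    by auto
  show ?thesis
  proof (intro exI conjI allI impI ballI)
    show "interval_len_ge {t0<..<t0 + e / (4 * M)} (e / (4 * M))"
      using \<open>0 \<le> t0\<close> by (rule interval_len_ge_greaterThanLessThan)
    fix z1 z2 t
    assume z: "resp_sol C W lam g x z1 \<and> z1 0 = a \<and> resp_sol C W lam g xt z2 \<and> z2 0 = a"
      and t: "t \<in> {t0<..<t0 + e / (4 * M)}"
    then have "z1 t = y1 t" "z2 t = y2 t"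
      using y1 y2 \<open>0 \<le> t0\<close> by (auto intro: resp_sol_unique)
    then show "e / 2 < norm (z1 t - z2 t)"
      using far[OF t] by simp
  qed
qed

lemma escape_radius_exists:
  fixes K P h :: real
  assumes "0 \<le> K" "0 < P" "0 < h"
  obtains e where "0 < e" "K * e \<le> P / 4" "8 * e < h * P"
proof
  define e where "e = P * min (1 / (4 * (K + 1))) (h / 16)"
  show "0 < e"
    unfolding e_def using assms by simp
  have e_le: "e \<le> P * (1 / (4 * (K + 1)))" "e \<le> P * (h / 16)"
    unfolding e_def using \<open>0 < P\<close> by (intro mult_left_mono; simp)+
  have "K * e \<le> K * (P * (1 / (4 * (K + 1))))"
    using e_le(1) \<open>0 \<le> K\<close> by (rule mult_left_mono)
  also have "\<dots> \<le> P / 4"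
    using assms by (simp add: field_simps)
  finally show "K * e \<le> P / 4" .
  have "0 < h * P"
    using assms by simp
  then show "8 * e < h * P"
    using e_le(2) by (simp add: mult.commute[of P h])
qed

locale drive_response =
  fixes C W Ct Wt :: mat3 and I :: vec3 and lam L :: real and g :: "vec3 \<Rightarrow> vec3"
    and A Lx Ly :: "vec3 set"
  assumes lam_nonzero: "lam \<noteq> 0" and L_pos: "0 < L"
    and Lx_compact: "compact Lx" and g_continuous: "continuous_on Lx g"
    and g_expansive: "\<And>v w. v \<in> Lx \<Longrightarrow> w \<in> Lx \<Longrightarrow> L * norm (v - w) \<le> norm (g v - g w)"
    and drive_in_Lx: "\<And>x t. drive_sol C W I x \<Longrightarrow> x 0 \<in> A \<Longrightarrow> 0 \<le> t \<Longrightarrow> x t \<in> Lx"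
    and Ly_bounded: "bounded Ly"
    and response_in_Ly: "\<And>x y t. drive_sol C W I x \<Longrightarrow> x 0 \<in> A \<Longrightarrow> resp_sol Ct Wt lam g x y \<Longrightarrow>
          y 0 \<in> Ly \<Longrightarrow> 0 \<le> t \<Longrightarrow> y t \<in> Ly"
begin

abbreviation chaotic_output :: "(real \<Rightarrow> vec3) \<Rightarrow> bool" where
  "chaotic_output x \<equiv> drive_sol C W I x \<and> x 0 \<in> A"

lemma drive_uniformly_lipschitz:
  obtains M where "0 < M" "\<And>x. chaotic_output x \<Longrightarrow> M-lipschitz_on {0..} x"
proof -
  obtain R where R: "0 < R" "\<And>v. v \<in> Lx \<Longrightarrow> norm v \<le> R"
    using compact_imp_bounded[OF Lx_compact] unfolding bounded_pos by blast
  define M where "M = (onorm ((*v) C) + onorm ((*v) W)) * R + norm I"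
  have "0 \<le> M"
    unfolding M_def using \<open>0 < R\<close>
    by (intro add_nonneg_nonneg mult_nonneg_nonneg onorm_pos_le matrix_vector_mul_bounded_linear) auto
  have lip: "M-lipschitz_on {0..} x" if "chaotic_output x" for x
    unfolding M_def using that drive_in_Lx R(2)
    by (intro hopfield_solution_lipschitz[where b = "\<lambda>_. I"]) (auto simp: drive_sol_iff)
  show thesis
  proof (rule that[of "M + 1"])
    show "0 < M + 1"
      using \<open>0 \<le> M\<close> by simp
    show "(M + 1)-lipschitz_on {0..} x" if "chaotic_output x" for x
      using lipschitz_on_le[OF lip[OF that]] by simp
  qed
qed

lemma forcing_equicontinuous:
  assumes "0 < \<eta>"
  obtains h where "0 < h"
    "\<And>x s t. chaotic_output x \<Longrightarrow> 0 \<le> s \<Longrightarrow> 0 \<le> t \<Longrightarrow> \<bar>t - s\<bar> \<le> h \<Longrightarrow> norm (g (x t) - g (x s)) < \<eta>"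
proof -
  obtain M where M: "0 < M" "\<And>x. chaotic_output x \<Longrightarrow> M-lipschitz_on {0..} x"
    using drive_uniformly_lipschitz by metis
  have "uniformly_continuous_on Lx g"
    by (rule compact_uniformly_continuous[OF g_continuous Lx_compact])
  then obtain \<rho> where "0 < \<rho>" and \<rho>: "\<forall>v\<in>Lx. \<forall>w\<in>Lx. dist w v < \<rho> \<longrightarrow> dist (g w) (g v) < \<eta>"
    using \<open>0 < \<eta>\<close> unfolding uniformly_continuous_on_def by blast
  show thesis
  proof (rule that[of "\<rho> / (2 * M)"])
    show "0 < \<rho> / (2 * M)"
      using \<open>0 < \<rho>\<close> \<open>0 < M\<close> by simp
    fix x s t assume x: "chaotic_output x" and "0 \<le> s" "0 \<le> t" and near: "\<bar>t - s\<bar> \<le> \<rho> / (2 * M)"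
    have "dist (x t) (x s) \<le> M * dist t s"
      using lipschitz_onD[OF M(2)[OF x]] \<open>0 \<le> s\<close> \<open>0 \<le> t\<close> by simp
    also have "\<dots> \<le> \<rho> / 2"
      using near \<open>0 < M\<close> by (simp add: dist_real_def field_simps)
    finally have "dist (x t) (x s) < \<rho>"
      using \<open>0 < \<rho>\<close> by simp
    then show "norm (g (x t) - g (x s)) < \<eta>"
      using \<rho> drive_in_Lx x \<open>0 \<le> s\<close> \<open>0 \<le> t\<close> by (simp add: dist_norm)
  qed
qed

lemma response_uniformly_lipschitz:
  obtains M where "0 < M"
    "\<And>x y. chaotic_output x \<Longrightarrow> resp_sol Ct Wt lam g x y \<Longrightarrow> y 0 \<in> Ly \<Longrightarrow> M-lipschitz_on {0..} y"
proof -
  obtain R where R: "0 < R" "\<And>v. v \<in> Ly \<Longrightarrow> norm v \<le> R"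
    using Ly_bounded unfolding bounded_pos by blast
  obtain G where G: "0 < G" "\<And>v. v \<in> Lx \<Longrightarrow> norm (g v) \<le> G"
    using compact_imp_bounded[OF compact_continuous_image[OF g_continuous Lx_compact]]
    unfolding bounded_pos by blast
  define M where "M = (onorm ((*v) Ct) + onorm ((*v) Wt)) * R + \<bar>lam\<bar> * G"
  show thesis
  proof (rule that[of M])
    show "0 < M"
      unfolding M_def using R G lam_nonzero
      by (intro add_nonneg_pos mult_nonneg_nonneg add_nonneg_nonneg onorm_pos_le
          matrix_vector_mul_bounded_linear) auto
    fix x y assume x: "chaotic_output x" and y: "resp_sol Ct Wt lam g x y" "y 0 \<in> Ly"
    show "M-lipschitz_on {0..} y"
      unfolding M_def
    proof (rule hopfield_solution_lipschitz[where b = "\<lambda>t. lam *\<^sub>R g (x t)"])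
      show "norm (lam *\<^sub>R g (x t)) \<le> \<bar>lam\<bar> * G" if "0 \<le> t" for t
        using G(2) drive_in_Lx x that by (simp add: mult_left_mono)
      show "(y has_vector_derivative hopfield_field Ct Wt (lam *\<^sub>R g (x t)) (y t)) (at t within {0..})"
        if "0 \<le> t" for t
        using y(1) that by (simp add: resp_sol_iff)
      show "norm (y t) \<le> R" if "0 \<le> t" for t
        using R(2) response_in_Ly x y that by blast
    qed
  qed
qed

lemma response_difference_escapes:
  assumes "0 < h"
    and x_steady: "\<And>t. t \<in> {s..s+h} \<Longrightarrow> norm (g (x t) - g (x s)) \<le> L * eps / 4"
    and xt_steady: "\<And>t. t \<in> {s..s+h} \<Longrightarrow> norm (g (xt t) - g (xt s)) \<le> L * eps / 4"
    and "0 \<le> s" "x s \<in> Lx" "xt s \<in> Lx" and separated: "eps \<le> norm (x s - xt s)"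
    and y1: "resp_sol Ct Wt lam g x y1" and y2: "resp_sol Ct Wt lam g xt y2"
    and e_small: "(onorm ((*v) Ct) + onorm ((*v) Wt)) * e \<le> \<bar>lam\<bar> * L * eps / 4"
      "8 * e < h * (\<bar>lam\<bar> * L * eps)"
  shows "\<exists>t\<in>{s..s+h}. e < norm (y1 t - y2 t)"
proof (rule forced_solution_escapes[where p = "\<lambda>t. lam *\<^sub>R (g (x t) - g (xt t))"
      and z' = "\<lambda>t. hopfield_field Ct Wt (lam *\<^sub>R g (x t)) (y1 t) - hopfield_field Ct Wt (lam *\<^sub>R g (xt t)) (y2 t)"])
  show "0 \<le> onorm ((*v) Ct) + onorm ((*v) Wt)"
    by (intro add_nonneg_nonneg onorm_pos_le matrix_vector_mul_bounded_linear)
  show "((\<lambda>t. y1 t - y2 t) has_vector_derivative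
      hopfield_field Ct Wt (lam *\<^sub>R g (x t)) (y1 t) - hopfield_field Ct Wt (lam *\<^sub>R g (xt t)) (y2 t))
      (at t within {s..s+h})" if "t \<in> {s..s+h}" for t
  proof (rule has_vector_derivative_within_subset)
    show "((\<lambda>t. y1 t - y2 t) has_vector_derivative
      hopfield_field Ct Wt (lam *\<^sub>R g (x t)) (y1 t) - hopfield_field Ct Wt (lam *\<^sub>R g (xt t)) (y2 t))
      (at t within {0..})"
      using y1 y2 that \<open>0 \<le> s\<close> by (intro has_vector_derivative_diff) (auto simp: resp_sol_iff)
  qed (use \<open>0 \<le> s\<close> in auto)
  show "norm (hopfield_field Ct Wt (lam *\<^sub>R g (x t)) (y1 t) - hopfield_field Ct Wt (lam *\<^sub>R g (xt t)) (y2 t)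
      - lam *\<^sub>R (g (x t) - g (xt t))) \<le> (onorm ((*v) Ct) + onorm ((*v) Wt)) * norm (y1 t - y2 t)" for t
    using norm_hopfield_field_diff_le by (simp add: scaleR_diff_right)
  have "L * eps \<le> L * norm (x s - xt s)"
    using separated L_pos by simp
  then have "\<bar>lam\<bar> * L * eps \<le> \<bar>lam\<bar> * (L * norm (x s - xt s))"
    by (simp add: mult.assoc mult_left_mono)
  also have "\<dots> \<le> \<bar>lam\<bar> * norm (g (x s) - g (xt s))"
    using g_expansive[OF \<open>x s \<in> Lx\<close> \<open>xt s \<in> Lx\<close>] by (simp add: mult_left_mono)
  finally show "\<bar>lam\<bar> * L * eps \<le> norm (lam *\<^sub>R (g (x s) - g (xt s)))"
    by simp
  show "norm (lam *\<^sub>R (g (x t) - g (xt t)) - lam *\<^sub>R (g (x s) - g (xt s))) \<le> \<bar>lam\<bar> * L * eps / 2"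
    if "t \<in> {s..s+h}" for t
  proof -
    have "norm ((g (x t) - g (x s)) - (g (xt t) - g (xt s))) \<le> L * eps / 4 + L * eps / 4"
      using norm_triangle_ineq4 x_steady[OF that] xt_steady[OF that] by (rule order_trans[OF _ add_mono])
    then have "\<bar>lam\<bar> * norm ((g (x t) - g (x s)) - (g (xt t) - g (xt s))) \<le> \<bar>lam\<bar> * (L * eps / 2)"
      by (intro mult_left_mono) simp_all
    moreover have "lam *\<^sub>R (g (x t) - g (xt t)) - lam *\<^sub>R (g (x s) - g (xt s))
        = lam *\<^sub>R ((g (x t) - g (x s)) - (g (xt t) - g (xt s)))"
      by (simp add: algebra_simps)
    ultimately show ?thesis
      by simp
  qed
qed (use \<open>0 < h\<close> e_small in auto)

lemma response_escapes:
  assumes "0 < h"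
    and steady: "\<And>x s t. chaotic_output x \<Longrightarrow> 0 \<le> s \<Longrightarrow> 0 \<le> t \<Longrightarrow> \<bar>t - s\<bar> \<le> h \<Longrightarrow>
      norm (g (x t) - g (x s)) < L * eps / 4"
    and e_small: "(onorm ((*v) Ct) + onorm ((*v) Wt)) * e \<le> \<bar>lam\<bar> * L * eps / 4"
      "8 * e < h * (\<bar>lam\<bar> * L * eps)"
    and x: "chaotic_output x" and xt: "chaotic_output xt"
    and "0 \<le> s" and separated: "eps < norm (x s - xt s)"
    and y1: "resp_sol Ct Wt lam g x y1" and y2: "resp_sol Ct Wt lam g xt y2"
  shows "\<exists>t\<ge>0. e < norm (y1 t - y2 t)"
proof -
  have "\<exists>t\<in>{s..s+h}. e < norm (y1 t - y2 t)"
  proof (rule response_difference_escapes[OF \<open>0 < h\<close> _ _ \<open>0 \<le> s\<close> _ _ _ y1 y2 e_small])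
    show "norm (g (x t) - g (x s)) \<le> L * eps / 4" "norm (g (xt t) - g (xt s)) \<le> L * eps / 4"
      if "t \<in> {s..s+h}" for t
      using steady[OF x \<open>0 \<le> s\<close>, of t] steady[OF xt \<open>0 \<le> s\<close>, of t] that \<open>0 \<le> s\<close> by auto
    show "x s \<in> Lx" "xt s \<in> Lx"
      using drive_in_Lx x xt \<open>0 \<le> s\<close> by auto
  qed (use separated in simp)
  then show ?thesis
    using \<open>0 \<le> s\<close> by (meson atLeastAtMost_iff order_trans)
qed

theorem response_sensitive:
  assumes "0 < eps" "0 < D"
    and drive_sensitive: "\<And>x. chaotic_output x \<Longrightarrow>
      \<exists>xt J. chaotic_output xt \<and> interval_len_ge J D \<and> (\<forall>t\<in>J. eps < norm (x t - xt t))"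
  shows "\<exists>epst>0. \<exists>Dt>0. \<forall>delt>0. \<forall>a1\<in>Ly. \<forall>x. chaotic_output x \<longrightarrow>
      (\<exists>a2\<in>Ly. \<exists>xt J. chaotic_output xt \<and> interval_len_ge J Dt \<and> norm (a1 - a2) < delt \<and>
        (\<forall>y1 y2. resp_sol Ct Wt lam g x y1 \<and> y1 0 = a1 \<and> resp_sol Ct Wt lam g xt y2 \<and> y2 0 = a2 \<longrightarrow>
          (\<forall>t\<in>J. epst < norm (y1 t - y2 t))))"
proof -
  have "0 < L * eps / 4"
    using L_pos \<open>0 < eps\<close> by simp
  then obtain h where "0 < h" and steady: "\<And>x s t. chaotic_output x \<Longrightarrow> 0 \<le> s \<Longrightarrow> 0 \<le> t \<Longrightarrow>
      \<bar>t - s\<bar> \<le> h \<Longrightarrow> norm (g (x t) - g (x s)) < L * eps / 4"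
    using forcing_equicontinuous by metis
  obtain M where "0 < M" and M: "\<And>x y. chaotic_output x \<Longrightarrow> resp_sol Ct Wt lam g x y \<Longrightarrow> y 0 \<in> Ly \<Longrightarrow>
      M-lipschitz_on {0..} y"
    using response_uniformly_lipschitz by metis
  have "0 \<le> onorm ((*v) Ct) + onorm ((*v) Wt)"
    by (intro add_nonneg_nonneg onorm_pos_le matrix_vector_mul_bounded_linear)
  moreover have "0 < \<bar>lam\<bar> * L * eps"
    using lam_nonzero L_pos \<open>0 < eps\<close> by simp
  ultimately obtain e where "0 < e" and e_small:
    "(onorm ((*v) Ct) + onorm ((*v) Wt)) * e \<le> \<bar>lam\<bar> * L * eps / 4" "8 * e < h * (\<bar>lam\<bar> * L * eps)"
    using \<open>0 < h\<close> by (rule escape_radius_exists)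
  have separates: "\<exists>xt J. chaotic_output xt \<and> interval_len_ge J (e / (4 * M)) \<and>
      (\<forall>y1 y2. resp_sol Ct Wt lam g x y1 \<and> y1 0 = a \<and> resp_sol Ct Wt lam g xt y2 \<and> y2 0 = a \<longrightarrow>
        (\<forall>t\<in>J. e / 2 < norm (y1 t - y2 t)))"
    if x: "chaotic_output x" and "a \<in> Ly" for x a
  proof -
    obtain xt J where xt: "chaotic_output xt" and "interval_len_ge J D"
      and separated: "\<forall>t\<in>J. eps < norm (x t - xt t)"
      using drive_sensitive[OF x] by blast
    obtain s where "s \<in> J" "0 \<le> s"
      using interval_len_geE[OF \<open>interval_len_ge J D\<close> \<open>0 < D\<close>] by metis
    have "\<exists>J. interval_len_ge J (e / (4 * M)) \<and>
        (\<forall>y1 y2. resp_sol Ct Wt lam g x y1 \<and> y1 0 = a \<and> resp_sol Ct Wt lam g xt y2 \<and> y2 0 = a \<longrightarrow>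
          (\<forall>t\<in>J. e / 2 < norm (y1 t - y2 t)))"
      using M x xt \<open>a \<in> Ly\<close> separated \<open>s \<in> J\<close>
        response_escapes[OF \<open>0 < h\<close> steady e_small x xt \<open>0 \<le> s\<close>]
      by (intro resp_sol_pair_separates[OF \<open>0 < M\<close>]) auto
    with xt show ?thesis
      by blast
  qed
  show ?thesis
  proof (intro exI conjI allI impI ballI)
    show "0 < e / 2" "0 < e / (4 * M)"
      using \<open>0 < e\<close> \<open>0 < M\<close> by simp_all
    fix delt :: real and a1 x assume "0 < delt" "a1 \<in> Ly" "chaotic_output x"
    then show "\<exists>a2\<in>Ly. \<exists>xt J. chaotic_output xt \<and> interval_len_ge J (e / (4 * M)) \<and> norm (a1 - a2) < delt \<and>
        (\<forall>y1 y2. resp_sol Ct Wt lam g x y1 \<and> y1 0 = a1 \<and> resp_sol Ct Wt lam g xt y2 \<and> y2 0 = a2 \<longrightarrow>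
          (\<forall>t\<in>J. e / 2 < norm (y1 t - y2 t)))"
      using separates[of x a1] by (intro bexI[of _ a1]) auto
  qed
qed

end

theorem theorem2:
  fixes c ct :: vec3 and W Wt :: mat3 and I :: vec3 and lam :: real
    and g :: "vec3 \<Rightarrow> vec3" and A Lx Ly :: "vec3 set" and L :: real
  assumes c_pos: "\<forall>i. c $ i > 0"
    and ct_pos: "\<forall>i. ct $ i > 0"
    and lam_nz: "lam \<noteq> 0"
    and g_cont: "\<forall>i. continuous_on UNIV (\<lambda>v. g v $ i)"
    and Lx_compact: "compact Lx"
    and A_sub: "A \<subseteq> Lx"
    and Lx_inv: "\<forall>x. drive_sol (diag3 c) W I x \<and> x 0 \<in> Lx \<longrightarrow> (\<forall>t\<ge>0. x t \<in> Lx)"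
    and drive_sens: "\<exists>eps>0. \<exists>D>0. \<forall>del>0. \<forall>x. drive_sol (diag3 c) W I x \<and> x 0 \<in> A \<longrightarrow>
          (\<exists>xt J. drive_sol (diag3 c) W I xt \<and> xt 0 \<in> A \<and> interval_len_ge J D \<and>
                  norm (x 0 - xt 0) < del \<and> (\<forall>t\<in>J. norm (x t - xt t) > eps))"
    and Ly_bdd: "bounded Ly"
    and Ly_inv: "\<forall>x y. drive_sol (diag3 c) W I x \<and> x 0 \<in> A \<and> resp_sol (diag3 ct) Wt lam g x y
          \<and> y 0 \<in> Ly \<longrightarrow> (\<forall>t\<ge>0. y t \<in> Ly)"
    and L_pos: "L > 0"
    and g_expand: "\<forall>v\<in>Lx. \<forall>w\<in>Lx. norm (g v - g w) \<ge> L * norm (v - w)"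
  shows "\<exists>epst>0. \<exists>Dt>0. \<forall>delt>0. \<forall>a1\<in>Ly. \<forall>x. drive_sol (diag3 c) W I x \<and> x 0 \<in> A \<longrightarrow>
          (\<exists>a2\<in>Ly. \<exists>xt J. drive_sol (diag3 c) W I xt \<and> xt 0 \<in> A \<and> interval_len_ge J Dt \<and>
              norm (a1 - a2) < delt \<and>
              (\<forall>y1 y2. resp_sol (diag3 ct) Wt lam g x y1 \<and> y1 0 = a1 \<and>
                       resp_sol (diag3 ct) Wt lam g xt y2 \<and> y2 0 = a2 \<longrightarrow>
                       (\<forall>t\<in>J. norm (y1 t - y2 t) > epst)))"
proof -
  have "continuous_on UNIV g"
    using continuous_on_vec_lambda[of UNIV "\<lambda>i v. g v $ i"] g_cont by (simp add: vec_lambda_eta)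
  interpret drive_response "diag3 c" W "diag3 ct" Wt I lam L g A Lx Ly
  proof
    show "continuous_on Lx g"
      using \<open>continuous_on UNIV g\<close> by (rule continuous_on_subset) simp
    show "x t \<in> Lx" if "drive_sol (diag3 c) W I x" "x 0 \<in> A" "0 \<le> t" for x t
      using Lx_inv A_sub that by blast
    show "y t \<in> Ly" if "drive_sol (diag3 c) W I x" "x 0 \<in> A" "resp_sol (diag3 ct) Wt lam g x y"
      "y 0 \<in> Ly" "0 \<le> t" for x y t
      using Ly_inv that by blast
  qed (use lam_nz L_pos Lx_compact g_expand Ly_bdd in auto)
  obtain eps D where "0 < eps" "0 < D" and sens: "\<forall>x. chaotic_output x \<longrightarrow>
      (\<exists>xt J. drive_sol (diag3 c) W I xt \<and> xt 0 \<in> A \<and> interval_len_ge J D \<and>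
        norm (x 0 - xt 0) < 1 \<and> (\<forall>t\<in>J. eps < norm (x t - xt t)))"
    \<comment> \<open>any \<open>\<delta>\<close> will do: closeness of the drive initial values is never used\<close>
    using drive_sens zero_less_one by blast
  have "\<exists>xt J. chaotic_output xt \<and> interval_len_ge J D \<and> (\<forall>t\<in>J. eps < norm (x t - xt t))"
    if "chaotic_output x" for x
    using sens that by blast
  from response_sensitive[OF \<open>0 < eps\<close> \<open>0 < D\<close> this] show ?thesis
    by (simp only: conj_assoc)
qed

end
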